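(* For every integer $K\ge 1$, no multi-stage fractional matching algorithm (deterministic or randomized) achieves a competitive ratio better than $\Gamma(K)=1-\left(1-\frac1K\right)^K$ in the $K$-stage unweighted matching problem: for every such algorithm $\mathrm{ALG}$, $\inf_I \frac{\mathrm{ALG}(I)}{\mathrm{OPT}(I)}\le\Gamma(K)$, the infimum being over all $K$-stage instances $I$.
   Context: $K$-stage unweighted (fractional) matching: a bipartite graph $G=(U,V,E)$ with offline vertices $V$ of unit capacity; online vertices arrive in $K$ stages as disjoint nonempty batches $U_1,\dots,U_K$ partitioning $U$, each revealing its incident edges upon arrival. After batch $k$ arrives, the algorithm irrevocably fractionally matches its vertices: $x_{k,ij}\ge 0$ on edges incident to $U_k$, each online vertex has total at most $1$, each offline vertex has cumulative total over all stages at most $1$. $\mathrm{ALG}(I)$ is the (expected, for randomized algorithms) size of the produced fractional matching, and $\mathrm{OPT}(I)$ is the maximum matching size of $G$. *)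

theory Defs
  imports "HOL-Probability.Probability" "HOL-Library.Infinite_Typeclass"
begin

text \<open>
  The sides of the bipartite graph are kept apart by typing: an edge is a pair of an
  online vertex (first component) and an offline vertex (second component).
  The stages are numbered from 1 to \<open>K\<close>; values of \<open>batch\<close> at other indices play no role.
\<close>

record ('u, 'v) stage_graph =
  offline :: "'v set"
  batch :: "nat \<Rightarrow> 'u set"
  edges :: "('u \<times> 'v) set"

definition stage_instance :: "nat \<Rightarrow> ('u, 'v) stage_graph \<Rightarrow> bool" where
  "stage_instance K I \<longleftrightarrow>
     finite (offline I) \<and>
     (\<forall>k\<in>{1..K}. finite (batch I k) \<and> batch I k \<noteq> {}) \<and>
     disjoint_family_on (batch I) {1..K} \<and>
     edges I \<subseteq> (\<Union>k\<in>{1..K}. batch I k) \<times> offline I"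

definition stage_edges :: "('u, 'v) stage_graph \<Rightarrow> nat \<Rightarrow> ('u \<times> 'v) set" where
  "stage_edges I k = {e \<in> edges I. fst e \<in> batch I k}"

definition matching :: "('u \<times> 'v) set \<Rightarrow> ('u \<times> 'v) set \<Rightarrow> bool" where
  "matching E M \<longleftrightarrow>
     M \<subseteq> E \<and> (\<forall>e\<in>M. \<forall>f\<in>M. e \<noteq> f \<longrightarrow> fst e \<noteq> fst f \<and> snd e \<noteq> snd f)"

definition opt :: "('u, 'v) stage_graph \<Rightarrow> nat" where
  "opt I = Max (card ` {M. matching (edges I) M})"

text \<open>
  A fractional allocation gives, for every stage \<open>k\<close>, a value \<open>x k i j\<close>; only the values on
  edges \<open>(i, j)\<close> incident to the \<open>k\<close>-th batch are meaningful.
\<close>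

definition feasible ::
    "nat \<Rightarrow> ('u, 'v) stage_graph \<Rightarrow> (nat \<Rightarrow> 'u \<Rightarrow> 'v \<Rightarrow> real) \<Rightarrow> bool" where
  "feasible K I x \<longleftrightarrow>
     (\<forall>k\<in>{1..K}. \<forall>(i, j)\<in>stage_edges I k. 0 \<le> x k i j) \<and>
     (\<forall>k\<in>{1..K}. \<forall>i\<in>batch I k. (\<Sum>j | (i, j) \<in> stage_edges I k. x k i j) \<le> 1) \<and>
     (\<forall>j\<in>offline I. (\<Sum>k = 1..K. \<Sum>i | (i, j) \<in> stage_edges I k. x k i j) \<le> 1)"

definition matching_size ::
    "nat \<Rightarrow> ('u, 'v) stage_graph \<Rightarrow> (nat \<Rightarrow> 'u \<Rightarrow> 'v \<Rightarrow> real) \<Rightarrow> real" where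
  "matching_size K I x = (\<Sum>k = 1..K. \<Sum>(i, j)\<in>stage_edges I k. x k i j)"

text \<open>
  An online policy sees the offline vertices and the list of batches revealed so far, each with
  its incident edges, and returns the allocation of the last batch in the list. Being a function
  of the history alone, it is non-anticipating, and its earlier allocations are
  irrevocable (and need not be recorded in the history, as the history determines them).
\<close>

type_synonym ('u, 'v) policy =
  "'v set \<Rightarrow> ('u set \<times> ('u \<times> 'v) set) list \<Rightarrow> 'u \<Rightarrow> 'v \<Rightarrow> real"

definition history ::
    "('u, 'v) stage_graph \<Rightarrow> nat \<Rightarrow> ('u set \<times> ('u \<times> 'v) set) list" where
  "history I k = map (\<lambda>l. (batch I l, stage_edges I l)) [1..<Suc k]"

definition run ::
    "('u, 'v) policy \<Rightarrow> ('u, 'v) stage_graph \<Rightarrow> nat \<Rightarrow> 'u \<Rightarrow> 'v \<Rightarrow> real" where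
  "run A I k = A (offline I) (history I k)"

definition det_algorithm :: "nat \<Rightarrow> ('u, 'v) policy \<Rightarrow> bool" where
  "det_algorithm K A \<longleftrightarrow> (\<forall>I. stage_instance K I \<longrightarrow> feasible K I (run A I))"

definition det_value :: "nat \<Rightarrow> ('u, 'v) policy \<Rightarrow> ('u, 'v) stage_graph \<Rightarrow> real" where
  "det_value K A I = matching_size K I (run A I)"

text \<open>
  A randomized algorithm is a random deterministic algorithm, with seed drawn from a
  probability space \<open>M\<close>, whose allocations on each instance are random variables.
\<close>

definition rand_algorithm ::
    "nat \<Rightarrow> 'w measure \<Rightarrow> ('w \<Rightarrow> ('u, 'v) policy) \<Rightarrow> bool" where
  "rand_algorithm K M R \<longleftrightarrow>
     prob_space M \<and>
     (\<forall>\<omega>\<in>space M. det_algorithm K (R \<omega>)) \<and>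
     (\<forall>I. stage_instance K I \<longrightarrow>
        (\<forall>k\<in>{1..K}. \<forall>(i, j)\<in>stage_edges I k. (\<lambda>\<omega>. run (R \<omega>) I k i j) \<in> borel_measurable M))"

definition rand_value ::
    "nat \<Rightarrow> 'w measure \<Rightarrow> ('w \<Rightarrow> ('u, 'v) policy) \<Rightarrow> ('u, 'v) stage_graph \<Rightarrow> real" where
  "rand_value K M R I = (\<integral>\<omega>. det_value K (R \<omega>) I \<partial>M)"

text \<open>
  Instances without edges are excluded, since \<open>0 / 0 = 0\<close> would make the infimum \<open>0\<close> for
  every algorithm. For an infinite vertex type and \<open>K \<ge> 1\<close> the remaining set of ratios is
  nonempty, and for an algorithm it is bounded below by \<open>0\<close>, so the real infimum is the
  true one.
\<close>

definition competitive_ratio :: "nat \<Rightarrow> (('u, 'v) stage_graph \<Rightarrow> real) \<Rightarrow> real" where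
  "competitive_ratio K alg =
     (INF I\<in>{I. stage_instance K I \<and> 0 < opt I}. alg I / real (opt I))"

end

theory Submission imports Defs begin

text \<open>
  The expectation of a randomized fractional allocation is itself a feasible online allocation,
  so only deterministic algorithms matter. Against such an algorithm, the adversary
  joins the \<open>k\<close>-th batch completely to a set \<open>W k\<close> of offline vertices, where \<open>W 1\<close> is the whole
  offline side and \<open>W (k + 1)\<close> consists of the most loaded vertices of \<open>W k\<close>. The sizes
  \<open>v k = card (W k)\<close> decrease by the factor \<open>1 - 1 / K\<close>, and the \<open>k\<close>-th batch has \<open>v k - v (k + 1)\<close>
  vertices (all of \<open>v K\<close> for \<open>k = K\<close>), so that it can be matched perfectly to \<open>W k - W (k + 1)\<close> and
  the optimum is \<open>v 1\<close>. If the algorithm allocates the amount \<open>a k\<close> in stage \<open>k\<close>, then the average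
  load of \<open>W K\<close> before the last stage is at least \<open>\<Sum>k<K. a k / v k\<close>. This limits the allocation in
  the last stage to \<open>v K * (1 - (\<Sum>k<K. a k / v k))\<close>, and the bound follows
  from \<open>a k \<le> v k - v (k + 1) = v k / K\<close> for \<open>k < K\<close>.
\<close>

section \<open>Heavily loaded nested sets\<close>

text \<open>Discarding an element of least value cannot lower the average of \<open>f\<close>, and
  this is repeated until \<open>m\<close> elements are left. The comparison of averages is
  cross-multiplied, so that empty sets cause no division by zero.\<close>

lemma heavy_subset:
  fixes f :: "'a \<Rightarrow> real"
  assumes "finite S" "m \<le> card S"
  shows "\<exists>T\<subseteq>S. card T = m \<and> real m * sum f S \<le> real (card S) * sum f T"
  using assms
proof (induction "card S - m" arbitrary: S)
  case 0
  then show ?case by (intro exI[of _ S]) auto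
next
  case (Suc d)
  then have "S \<noteq> {}" by auto
  then obtain a where "is_arg_min f (\<lambda>x. x \<in> S) a"
    using ex_is_arg_min_if_finite[OF \<open>finite S\<close>, of f] by blast
  then have a: "a \<in> S" "\<forall>s\<in>S. f a \<le> f s"
    unfolding is_arg_min_linorder by blast+
  have card: "card S = Suc (card (S - {a}))"
    using a Suc.prems by (intro card.remove)
  have "d = card (S - {a}) - m" "m \<le> card (S - {a})"
    using Suc.hyps(2) card by auto
  then obtain T where T: "T \<subseteq> S - {a}" "card T = m"
      "real m * sum f (S - {a}) \<le> real (card (S - {a})) * sum f T"
    using Suc.hyps(1)[of "S - {a}"] Suc.prems by auto
  \<comment> \<open>Every element of \<open>T\<close> has value at least \<open>f a\<close>. So the
    discarded term costs at most one more copy of \<open>sum f T\<close>, which turns the factor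
    \<open>card (S - {a})\<close> into \<open>card S\<close>.\<close>
  have "real m * f a \<le> sum f T"
    using sum_bounded_below[of T "f a" f] a T by auto
  moreover have "sum f S = f a + sum f (S - {a})"
    using a Suc.prems by (intro sum.remove)
  ultimately have "real m * sum f S \<le> real (card S) * sum f T"
    using T(3) card by (simp add: algebra_simps)
  with T show ?case by blast
qed

text \<open>Here \<open>F W k j\<close> stands for the load put on \<open>j\<close> in stage
  \<open>k\<close> against the sets \<open>W\<close>. As it depends on \<open>W 1\<close> to
  \<open>W k\<close> only, the sets can be chosen greedily: the next one is a heavy subset for the
  loads accumulated so far. The average load never drops in this passage, and stage \<open>k\<close>
  raises the average over \<open>W k\<close> by its total divided by \<open>v k\<close>.\<close>

lemma heavy_nested_sets:
  fixes F :: "(nat \<Rightarrow> 'v set) \<Rightarrow> nat \<Rightarrow> 'v \<Rightarrow> real" and v :: "nat \<Rightarrow> nat"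
  assumes "1 \<le> K"
    and nonanticipating: "\<And>W W' k. (\<And>l. l \<in> {1..k} \<Longrightarrow> W l = W' l) \<Longrightarrow> F W k = F W' k"
    and V: "finite V" "card V = v 1"
    and antimono: "\<And>k. k \<in> {1..<K} \<Longrightarrow> v (Suc k) \<le> v k"
    and pos: "\<And>k. k \<in> {1..K} \<Longrightarrow> 0 < v k"
  shows "\<exists>W. W 1 = V \<and> (\<forall>k\<in>{1..<K}. W (Suc k) \<subseteq> W k) \<and> (\<forall>k\<in>{1..K}. card (W k) = v k) \<and>
    real (v K) * (\<Sum>k=1..<K. (\<Sum>j\<in>W k. F W k j) / v k) \<le> (\<Sum>j\<in>W K. \<Sum>k=1..<K. F W k j)"
  using assms(1) antimono pos
proof (induction K rule: dec_induct)
  case base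
  show ?case by (intro exI[of _ "\<lambda>_. V"]) (use V in auto)
next
  case (step n)
  then obtain W where W: "W 1 = V" "\<And>k. k \<in> {1..<n} \<Longrightarrow> W (Suc k) \<subseteq> W k"
    "\<And>k. k \<in> {1..n} \<Longrightarrow> card (W k) = v k"
    "real (v n) * (\<Sum>k=1..<n. (\<Sum>j\<in>W k. F W k j) / v k) \<le> (\<Sum>j\<in>W n. \<Sum>k=1..<n. F W k j)"
    by (auto simp: Ball_def)
  have n: "1 \<le> n" "v (Suc n) \<le> v n" "0 < v n" "card (W n) = v n"
    using step W(3) by auto
  define f where "f j = (\<Sum>k=1..<Suc n. F W k j)" for j
  have "finite (W n)" using n card_gt_0_iff[of "W n"] by simp
  then obtain T where T: "T \<subseteq> W n" "card T = v (Suc n)"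
      "real (v (Suc n)) * sum f (W n) \<le> real (v n) * sum f T"
    using heavy_subset[of "W n" "v (Suc n)" f] n by auto
  \<comment> \<open>Only the set of stage \<open>Suc n\<close> changes, so the loads of the stages
    up to \<open>n\<close>, by which \<open>T\<close> was chosen, remain valid.\<close>
  define W' where "W' = W(Suc n := T)"
  have F: "F W' k = F W k" if "k \<le> n" for k
    by (rule nonanticipating) (use that in \<open>auto simp: W'_def\<close>)
  have W': "W' k = W k" if "k \<le> n" for k
    using that by (auto simp: W'_def)
  define s where "s = (\<Sum>k=1..<Suc n. (\<Sum>j\<in>W k. F W k j) / v k)"
  have "real (v n) * s = real (v n) * (\<Sum>k=1..<n. (\<Sum>j\<in>W k. F W k j) / v k) + (\<Sum>j\<in>W n. F W n j)"
    using n by (simp add: s_def distrib_left)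
  also have "\<dots> \<le> sum f (W n)"
    using W(4) n by (simp add: f_def sum.distrib)
  finally have "real (v (Suc n)) * (real (v n) * s) \<le> real (v (Suc n)) * sum f (W n)"
    by (intro mult_left_mono) auto
  with T(3) have "real (v n) * (real (v (Suc n)) * s) \<le> real (v n) * sum f T"
    by (simp add: mult.left_commute)
  with n have "real (v (Suc n)) * s \<le> sum f T" by simp
  moreover have "(\<Sum>k=1..<Suc n. (\<Sum>j\<in>W' k. F W' k j) / v k) = s"
    unfolding s_def by (rule sum.cong) (simp_all add: F W')
  moreover have "(\<Sum>j\<in>W' (Suc n). \<Sum>k=1..<Suc n. F W' k j) = sum f T"
    unfolding f_def by (intro sum.cong) (simp_all add: F, simp add: W'_def)
  ultimately have "real (v (Suc n)) * (\<Sum>k=1..<Suc n. (\<Sum>j\<in>W' k. F W' k j) / v k)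
      \<le> (\<Sum>j\<in>W' (Suc n). \<Sum>k=1..<Suc n. F W' k j)"
    by simp
  moreover have "W' (Suc k) \<subseteq> W' k" if "k \<in> {1..<Suc n}" for k
    using that W(2)[of k] T(1) by (cases "k = n") (auto simp: W'_def)
  moreover have "card (W' k) = v k" if "k \<in> {1..Suc n}" for k
    using that W(3)[of k] T(2) by (cases "k = Suc n") (auto simp: W'_def)
  moreover have "W' 1 = V" using W n by (simp add: W'_def)
  ultimately show ?case by blast
qed

section \<open>Instances with completely joined batches\<close>

definition joined_instance ::
    "nat \<Rightarrow> (nat \<Rightarrow> 'u set) \<Rightarrow> (nat \<Rightarrow> 'v set) \<Rightarrow> ('u, 'v) stage_graph" where
  "joined_instance K U W =
     \<lparr>offline = W 1, batch = U, edges = (\<Union>k\<in>{1..K}. U k \<times> W k)\<rparr>"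

lemma joined_instance_simps [simp]:
  "offline (joined_instance K U W) = W 1"
  "batch (joined_instance K U W) = U"
  "edges (joined_instance K U W) = (\<Union>k\<in>{1..K}. U k \<times> W k)"
  by (simp_all add: joined_instance_def)

lemma stage_edges_joined_instance:
  assumes "disjoint_family_on U {1..K}" "k \<in> {1..K}"
  shows "stage_edges (joined_instance K U W) k = U k \<times> W k"
proof -
  have same: "l = k" if "l \<in> {1..K}" "i \<in> U l" "i \<in> U k" for l i
    using disjoint_family_onD[OF assms(1) that(1) assms(2)] that by blast
  show ?thesis
  proof (intro set_eqI iffI)
    fix e assume "e \<in> stage_edges (joined_instance K U W) k"
    then obtain l where l: "l \<in> {1..K}" "fst e \<in> U l" "snd e \<in> W l" "fst e \<in> U k"
      by (auto simp: stage_edges_def)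
    then show "e \<in> U k \<times> W k" using same[OF l(1,2,4)] by (cases e) auto
  next
    fix e assume "e \<in> U k \<times> W k"
    with assms(2) show "e \<in> stage_edges (joined_instance K U W) k"
      by (auto simp: stage_edges_def)
  qed
qed

text \<open>For fixed \<open>U\<close>, only \<open>W 1\<close> to \<open>W k\<close> occur on the
  right. This is what makes the loads up to stage \<open>k\<close> independent of the later choices
  of the adversary.\<close>

lemma history_joined_instance:
  assumes "disjoint_family_on U {1..K}" "k \<in> {1..K}"
  shows "history (joined_instance K U W) k = map (\<lambda>l. (U l, U l \<times> W l)) [1..<Suc k]"
  unfolding history_def using assms
  by (intro map_cong) (auto simp: stage_edges_joined_instance)

section \<open>Lower bounds on the optimum\<close>

lemma finite_matching_cards:
  assumes "stage_instance K I"
  shows "finite (edges I)" "finite (card ` {M. matching (edges I) M})"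
proof -
  show fin: "finite (edges I)"
    using assms unfolding stage_instance_def
    by (elim conjE, elim finite_subset) blast
  have "{M. matching (edges I) M} \<subseteq> Pow (edges I)"
    by (auto simp: matching_def)
  then show "finite (card ` {M. matching (edges I) M})"
    using fin by (meson finite_Pow_iff finite_imageI finite_subset)
qed

lemma card_le_opt:
  assumes "stage_instance K I" "matching (edges I) M"
  shows "card M \<le> opt I"
  unfolding opt_def using assms finite_matching_cards(2) by (intro Max_ge) auto

lemma nested_subset:
  assumes "\<And>k. k \<in> {1..K} \<Longrightarrow> W (Suc k) \<subseteq> W k" "l \<in> {1..m}" "m \<le> Suc K"
  shows "W m \<subseteq> W l"
proof -
  have "l \<le> m" using assms by simp
  then show ?thesis using assms(2,3)
  proof (induction m rule: dec_induct)
    case (step n)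
    then show ?case using assms(1)[of n] by auto
  qed simp
qed

text \<open>The layers \<open>W k - W (Suc k)\<close> partition \<open>W 1\<close>, since the chain
  ends in the empty set. Batch \<open>k\<close> is joined completely to its layer and has the same
  size, so bijections on the layers combine to a matching that covers \<open>W 1\<close>.\<close>

lemma card_le_opt_joined_instance:
  fixes U :: "nat \<Rightarrow> 'u set" and W :: "nat \<Rightarrow> 'v set"
  assumes inst: "stage_instance K (joined_instance K U W)"
    and nested: "\<And>k. k \<in> {1..K} \<Longrightarrow> W (Suc k) \<subseteq> W k"
    and last: "W (Suc K) = {}"
    and card: "\<And>k. k \<in> {1..K} \<Longrightarrow> card (U k) = card (W k - W (Suc k))"
    and "1 \<le> K"
  shows "card (W 1) \<le> opt (joined_instance K U W)"
proof -
  have fin: "finite (W k)" if "k \<in> {1..K}" for k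
    using inst nested_subset[of K W 1 k] nested that
    by (auto simp: stage_instance_def intro: finite_subset)
  have "\<exists>b. bij_betw b (W k - W (Suc k)) (U k)" if "k \<in> {1..K}" for k
    using that fin card inst by (intro finite_same_card_bij) (auto simp: stage_instance_def)
  then obtain b where b: "\<And>k. k \<in> {1..K} \<Longrightarrow> bij_betw (b k) (W k - W (Suc k)) (U k)"
    by metis
  define M where "M = (\<Union>k\<in>{1..K}. (\<lambda>j. (b k j, j)) ` (W k - W (Suc k)))"
  have disj: "k = l" if "k \<in> {1..K}" "l \<in> {1..K}" "i \<in> U k" "i \<in> U l" for k l i
  proof -
    have "disjoint_family_on U {1..K}" using inst by (simp add: stage_instance_def)
    from disjoint_family_onD[OF this that(1,2)] that(3,4) show ?thesis by blast
  qed
  have disjW: "k = l" if "k \<in> {1..K}" "l \<in> {1..K}" "j \<in> W k - W (Suc k)" "j \<in> W l - W (Suc l)"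
    for k l j
  proof (rule ccontr)
    assume "k \<noteq> l"
    then have "Suc k \<le> l \<or> Suc l \<le> k" by auto
    then show False
      using nested_subset[of K W "Suc k" l] nested_subset[of K W "Suc l" k] nested that
      by auto
  qed
  have bU: "b k j \<in> U k" if "k \<in> {1..K}" "j \<in> W k - W (Suc k)" for k j
    using b[OF that(1)] that(2) by (auto simp: bij_betw_def)
  have inj: "j = j'" if "k \<in> {1..K}" "j \<in> W k - W (Suc k)" "j' \<in> W k - W (Suc k)" "b k j = b k j'"
    for k j j'
    using b[OF that(1)] that(2-) by (auto simp: bij_betw_def inj_on_def)
  have "matching (edges (joined_instance K U W)) M"
    unfolding matching_def
  proof (intro conjI ballI impI)
    show "M \<subseteq> edges (joined_instance K U W)"
      using bU by (fastforce simp: M_def)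
    fix e f assume "e \<in> M" "f \<in> M" "e \<noteq> f"
    then obtain k l j j' where kl: "k \<in> {1..K}" "j \<in> W k - W (Suc k)" "e = (b k j, j)"
        "l \<in> {1..K}" "j' \<in> W l - W (Suc l)" "f = (b l j', j')"
      unfolding M_def by blast
    have "k = l" if "fst e = fst f"
      using disj[of k l "b k j"] bU[of k j] bU[of l j'] kl that by simp
    then show "fst e \<noteq> fst f" using inj[of k j j'] kl \<open>e \<noteq> f\<close> by auto
    show "snd e \<noteq> snd f" using disjW[of k l j] kl \<open>e \<noteq> f\<close> by auto
  qed
  then have "card M \<le> opt (joined_instance K U W)"
    by (rule card_le_opt[OF inst])
  moreover have "W 1 \<subseteq> snd ` M"
  proof
    fix j assume j: "j \<in> W 1"
    \<comment> \<open>The layer of \<open>j\<close> belongs to the last stage whose set contains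
      \<open>j\<close>.\<close>
    define k where "k = Max {k\<in>{1..K}. j \<in> W k}"
    have k: "k \<in> {k\<in>{1..K}. j \<in> W k}"
      unfolding k_def by (rule Max_in) (use j \<open>1 \<le> K\<close> in auto)
    have "j \<notin> W (Suc k)"
    proof
      assume "j \<in> W (Suc k)"
      then have "Suc k \<in> {k\<in>{1..K}. j \<in> W k}"
        using k last by (cases "k = K") auto
      then have "Suc k \<le> k" unfolding k_def by (intro Max_ge) auto
      then show False by simp
    qed
    then show "j \<in> snd ` M" using k by (force simp: M_def)
  qed
  moreover have "finite M" using fin by (auto simp: M_def)
  ultimately show ?thesis
    by (meson card_mono card_image_le finite_imageI le_trans)
qed

text \<open>An injective sequence indexed by pairs has infinitely many disjoint infinite rows;
  \<open>U k\<close> takes the first \<open>u k\<close> entries of row \<open>k\<close>.\<close>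

lemma card_disjoint_family_exists:
  fixes u :: "nat \<Rightarrow> nat"
  assumes "infinite (UNIV :: 'u set)"
  shows "\<exists>U :: nat \<Rightarrow> 'u set. (\<forall>k. finite (U k)) \<and> (\<forall>k. card (U k) = u k) \<and> disjoint_family U"
proof -
  obtain e :: "nat \<Rightarrow> 'u" where e: "inj e"
    using assms infinite_countable_subset by blast
  define U where "U k = (\<lambda>i. e (prod_encode (k, i))) ` {..<u k}" for k
  have "card (U k) = u k" for k
    unfolding U_def by (subst card_image) (auto simp: inj_on_def dest!: injD[OF e])
  moreover have "disjoint_family U"
    by (auto simp: disjoint_family_on_def U_def dest!: injD[OF e])
  moreover have "finite (U k)" for k by (simp add: U_def)
  ultimately show ?thesis by blast
qed

section \<open>Deterministic algorithms\<close>

text \<open>For \<open>1 \<le> k \<le> K\<close> this is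
  \<open>K ^ (K - 1) * (1 - 1 / K) ^ (k - 1)\<close>, the leading factor being chosen to make all
  sizes integers. The value 0 beyond \<open>K\<close> lets
  \<open>layer_size K k - layer_size K (Suc k)\<close> give the size of the last batch as
  well.\<close>

definition layer_size :: "nat \<Rightarrow> nat \<Rightarrow> nat" where
  "layer_size K k = (if k \<le> K then (K - 1) ^ (k - 1) * K ^ (K - k) else 0)"

lemma layer_size_pos: "k \<in> {1..K} \<Longrightarrow> 0 < layer_size K k"
  \<comment> \<open>For \<open>K = 1\<close> the base \<open>K - 1\<close> is 0, and positivity
    rests on \<open>0 ^ 0 = 1\<close>.\<close>
  by (cases "K = 1") (auto simp: layer_size_def)

text \<open>This is the decrease by the factor \<open>1 - 1 / K\<close>, free of division and
  truncated subtraction.\<close>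

lemma layer_size_Suc:
  assumes "k \<in> {1..<K}"
  shows "K * layer_size K (Suc k) + layer_size K k = K * layer_size K k"
proof -
  obtain m where m: "k = Suc m" using assms by (cases k) auto
  obtain d where d: "K = Suc (k + d)" using assms less_iff_Suc_add by auto
  show ?thesis
    unfolding layer_size_def by (simp add: m d algebra_simps)
qed

lemma layer_size_Suc_less:
  assumes "k \<in> {1..K}"
  shows "layer_size K (Suc k) < layer_size K k"
proof (cases "k = K")
  case True
  then show ?thesis using layer_size_pos[OF assms] by (simp add: layer_size_def)
next
  case False
  then have "K * layer_size K (Suc k) < K * layer_size K k"
    using layer_size_Suc[of k K] layer_size_pos[OF assms] assms
    by (metis False atLeastAtMost_iff atLeastLessThan_iff le_neq_implies_less less_add_same_cancel1)
  then show ?thesis by simp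
qed

text \<open>The coefficients \<open>1 - v K / v k\<close> are nonnegative, so the left side is
  largest when every \<open>a k\<close> attains its bound \<open>v k / K\<close>. It then telescopes
  to \<open>v 1 - (K - 1) * v K / K\<close>, and the subtracted term equals
  \<open>(1 - 1 / K) ^ K * v 1\<close>.\<close>

lemma layer_size_bound:
  assumes "1 \<le> K"
  defines "v \<equiv> \<lambda>k. real (layer_size K k)"
  assumes a: "\<And>k. k \<in> {1..<K} \<Longrightarrow> a k \<le> v k - v (Suc k)"
  shows "v K + (\<Sum>k=1..<K. a k * (1 - v K / v k)) \<le> (1 - (1 - 1 / real K) ^ K) * v 1"
proof -
  have v: "real K * v (Suc k) + v k = real K * v k" "0 < v k" if "k \<in> {1..<K}" for k
    using layer_size_Suc[OF that] layer_size_pos[of k K] that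
    unfolding v_def by (auto simp flip: of_nat_mult of_nat_add)
  have diff: "v k - v (Suc k) = v k / K" if "k \<in> {1..<K}" for k
    using v(1)[OF that] \<open>1 \<le> K\<close> by (simp add: field_simps)
  have le: "v K \<le> v k" if "k \<in> {1..<K}" for k
  proof -
    have "k \<le> K" using that by simp
    then show ?thesis using that
    proof (induction k rule: inc_induct)
      case (step n)
      then show ?case
        using layer_size_Suc_less[of n K] by (cases "Suc n = K") (auto simp: v_def)
    qed simp
  qed
  have "(\<Sum>k=1..<K. a k * (1 - v K / v k)) \<le> (\<Sum>k=1..<K. (v k - v (Suc k)) * (1 - v K / v k))"
    using a v(2) le by (intro sum_mono mult_right_mono) (auto simp: field_simps)
  also have "\<dots> = (\<Sum>k=1..<K. (v k - v (Suc k)) - v K / K)"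
  \<comment> \<open>The correction \<open>(v k / K) * (v K / v k)\<close> is the same for all
    \<open>k\<close>.\<close>
  proof (rule sum.cong[OF refl])
    fix k assume k: "k \<in> {1..<K}"
    have "(v k - v (Suc k)) * (1 - v K / v k) = (v k - v (Suc k)) - v k / K * (v K / v k)"
      by (simp add: diff[OF k] algebra_simps)
    also have "v k / K * (v K / v k) = v K / K"
      using v(2)[OF k] by simp
    finally show "(v k - v (Suc k)) * (1 - v K / v k) = (v k - v (Suc k)) - v K / K" .
  qed
  also have "\<dots> = v 1 - v K - (real K - 1) * (v K / K)"
    using sum_Suc_diff'[OF \<open>1 \<le> K\<close>, of "\<lambda>k. - v k"] \<open>1 \<le> K\<close>
    by (simp add: sum_subtractf of_nat_diff)
  finally have "v K + (\<Sum>k=1..<K. a k * (1 - v K / v k)) \<le> v 1 - (real K - 1) * (v K / K)"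
    by simp
  also have "\<dots> = (1 - (1 - 1 / real K) ^ K) * v 1"
  proof -
    \<comment> \<open>With \<open>n = K - 1\<close>, the extreme sizes are
      \<open>v 1 = K ^ n\<close> and \<open>v K = n ^ n\<close>.\<close>
    obtain n where n: "K = Suc n" using \<open>1 \<le> K\<close> by (cases K) auto
    have "y ^ n - x * (x ^ n / y) = (1 - (x / y) ^ Suc n) * y ^ n" if "y \<noteq> 0" for x y :: real
      using that by (simp add: power_divide left_diff_distrib)
    from this[of "real K" "real n"] have
      "real K ^ n - real n * (real n ^ n / real K) = (1 - (real n / real K) ^ K) * real K ^ n"
      by (simp add: n)
    moreover have "1 - 1 / real K = real n / real K" by (simp add: n field_simps)
    ultimately show ?thesis
      by (simp add: v_def layer_size_def n)
  qed
  finally show ?thesis .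
qed

section \<open>The hard instance against a deterministic algorithm\<close>

lemma feasible_nonneg:
  assumes "feasible K I x" "k \<in> {1..K}" "(i, j) \<in> stage_edges I k"
  shows "0 \<le> x k i j"
  using assms unfolding feasible_def by blast

lemma feasible_online_le:
  assumes "feasible K I x" "k \<in> {1..K}" "i \<in> batch I k"
  shows "(\<Sum>j | (i, j) \<in> stage_edges I k. x k i j) \<le> 1"
  using assms unfolding feasible_def by blast

lemma feasible_offline_le:
  assumes "feasible K I x" "j \<in> offline I"
  shows "(\<Sum>k = 1..K. \<Sum>i | (i, j) \<in> stage_edges I k. x k i j) \<le> 1"
  using assms unfolding feasible_def by blast

lemma hard_instance_exists:
  fixes A :: "('u::infinite, 'v::infinite) policy"
  assumes "1 \<le> K" and A: "det_algorithm K A"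
  shows "\<exists>I. stage_instance K I \<and> 0 < opt I \<and>
           det_value K A I \<le> (1 - (1 - 1 / real K) ^ K) * opt I"
proof -
  let ?v = "layer_size K"
  obtain U :: "nat \<Rightarrow> 'u set" where U: "\<And>k. finite (U k)"
      "\<And>k. card (U k) = ?v k - ?v (Suc k)" "disjoint_family U"
    using card_disjoint_family_exists[OF infinite_UNIV, where u = "\<lambda>k. ?v k - ?v (Suc k)"]
    by blast
  obtain V :: "'v set" where V: "finite V" "card V = ?v 1"
    using infinite_arbitrarily_large[OF infinite_UNIV] by blast
  \<comment> \<open>A deterministic policy can be simulated before the instance is fixed:
    \<open>F W k j\<close> is the load that \<open>A\<close> puts on \<open>j\<close> in stage
    \<open>k\<close> when shown the history generated by \<open>W\<close>.\<close>
  define F where "F W k j = (\<Sum>i\<in>U k. A V (map (\<lambda>l. (U l, U l \<times> W l)) [1..<Suc k]) i j)" for W k j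
  have F_cong: "F W k = F W' k" if "\<And>l. l \<in> {1..k} \<Longrightarrow> W l = W' l" for W W' k
  proof -
    have "map (\<lambda>l. (U l, U l \<times> W l)) [1..<Suc k] = map (\<lambda>l. (U l, U l \<times> W' l)) [1..<Suc k]"
      using that by (intro map_cong) auto
    then show ?thesis by (intro ext) (simp only: F_def)
  qed
  have "\<exists>W. W 1 = V \<and> (\<forall>k\<in>{1..<K}. W (Suc k) \<subseteq> W k) \<and> (\<forall>k\<in>{1..K}. card (W k) = ?v k) \<and>
    real (?v K) * (\<Sum>k=1..<K. (\<Sum>j\<in>W k. F W k j) / ?v k) \<le> (\<Sum>j\<in>W K. \<Sum>k=1..<K. F W k j)"
  proof (rule heavy_nested_sets[where K = K and v = ?v and V = V and F = F])
    show "F W k = F W' k" if "\<And>l. l \<in> {1..k} \<Longrightarrow> W l = W' l" for W W' k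
      using that by (rule F_cong)
    show "?v (Suc k) \<le> ?v k" if "k \<in> {1..<K}" for k
      using layer_size_Suc_less[of k K] that by simp
  qed (use \<open>1 \<le> K\<close> V layer_size_pos in auto)
  then obtain W0 where W0: "W0 1 = V" "\<And>k. k \<in> {1..<K} \<Longrightarrow> W0 (Suc k) \<subseteq> W0 k"
      "\<And>k. k \<in> {1..K} \<Longrightarrow> card (W0 k) = ?v k"
      "real (?v K) * (\<Sum>k=1..<K. (\<Sum>j\<in>W0 k. F W0 k j) / ?v k) \<le> (\<Sum>j\<in>W0 K. \<Sum>k=1..<K. F W0 k j)"
    by (auto simp: Ball_def)
  \<comment> \<open>The appended empty set makes all of \<open>W K\<close> the last layer; stages up
    to \<open>K\<close> are unaffected.\<close>
  define W where "W = W0(Suc K := {})"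
  have W_eq: "W k = W0 k" "F W k = F W0 k" if "k \<le> K" for k
    using that by (auto simp: W_def intro!: F_cong)
  have W1: "W 1 = V" using W0(1) \<open>1 \<le> K\<close> by (simp add: W_eq)
  have last: "W (Suc K) = {}" by (simp add: W_def)
  have nested: "W (Suc k) \<subseteq> W k" if "k \<in> {1..K}" for k
    using W0(2)[of k] that by (cases "k = K") (auto simp: W_def)
  have card: "card (W k) = ?v k" if "k \<in> {1..K}" for k
    using W0(3)[of k] that by (simp add: W_eq)
  have load: "real (?v K) * (\<Sum>k=1..<K. (\<Sum>j\<in>W k. F W k j) / ?v k)
      \<le> (\<Sum>j\<in>W K. \<Sum>k=1..<K. F W k j)"
  proof -
    have "(\<Sum>k=1..<K. (\<Sum>j\<in>W k. F W k j) / ?v k) = (\<Sum>k=1..<K. (\<Sum>j\<in>W0 k. F W0 k j) / ?v k)"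
      by (rule sum.cong) (simp_all add: W_eq)
    moreover have "(\<Sum>j\<in>W K. \<Sum>k=1..<K. F W k j) = (\<Sum>j\<in>W0 K. \<Sum>k=1..<K. F W0 k j)"
      by (intro sum.cong) (simp_all add: W_eq)
    ultimately show ?thesis using W0(4) by simp
  qed
  have W_sub: "W k \<subseteq> W l" if "l \<in> {1..k}" "k \<le> K" for k l
    using nested_subset[of K W l k] nested that by simp
  have finW: "finite (W k)" if "k \<in> {1..K}" for k
    using W_sub[of 1 k] that V(1) W1 by (simp add: finite_subset)
  have disj: "disjoint_family_on U {1..K}"
    using U(3) by (auto simp: disjoint_family_on_def)

  define I where "I = joined_instance K U W"
  have se: "stage_edges I k = U k \<times> W k" if "k \<in> {1..K}" for k
    unfolding I_def using disj that by (rule stage_edges_joined_instance)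
  have inst: "stage_instance K I"
    unfolding stage_instance_def
  proof (intro conjI ballI)
    show "finite (offline I)" using V W1 by (simp add: I_def)
    show "disjoint_family_on (batch I) {1..K}" using disj by (simp add: I_def)
    show "edges I \<subseteq> (\<Union>k\<in>{1..K}. batch I k) \<times> offline I"
      using W_sub[of 1] unfolding I_def joined_instance_simps by fastforce
    fix k assume k: "k \<in> {1..K}"
    have "card (U k) \<noteq> 0" using U(2) layer_size_Suc_less[OF k] by simp
    then show "finite (batch I k)" "batch I k \<noteq> {}"
      using U(1) by (auto simp: I_def)
  qed
  have "card (W 1) \<le> opt I"
    unfolding I_def
  proof (rule card_le_opt_joined_instance[OF _ nested last _ \<open>1 \<le> K\<close>])
    show "stage_instance K (joined_instance K U W)" using inst by (simp add: I_def)
    fix k assume k: "k \<in> {1..K}"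
    have "card (W (Suc k)) = ?v (Suc k)"
      using card[of "Suc k"] k last by (cases "k = K") (auto simp: layer_size_def)
    moreover have "finite (W (Suc k))"
      using finW[OF k] nested[OF k] by (rule finite_subset[rotated])
    ultimately show "card (U k) = card (W k - W (Suc k))"
      using nested[OF k] card[OF k] U(2) by (simp add: card_Diff_subset)
  qed
  then have opt: "?v 1 \<le> opt I" using V W1 by simp

  have feas: "feasible K I (run A I)"
    using A inst by (simp add: det_algorithm_def)
  have run: "run A I k = A V (map (\<lambda>l. (U l, U l \<times> W l)) [1..<Suc k])" if "k \<in> {1..K}" for k
    using history_joined_instance[OF disj that, of W] W1 by (simp add: run_def I_def)
  have F_run: "F W k j = (\<Sum>i\<in>U k. run A I k i j)" if "k \<in> {1..K}" for k j
    by (simp only: F_def run[OF that])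
  define a where "a k = (\<Sum>j\<in>W k. F W k j)" for k
  have a_run: "a k = (\<Sum>i\<in>U k. \<Sum>j\<in>W k. run A I k i j)" if "k \<in> {1..K}" for k
    unfolding a_def F_run[OF that] by (rule sum.swap)
  have total: "det_value K A I = (\<Sum>k=1..K. a k)"
    unfolding det_value_def matching_size_def
    by (intro sum.cong refl) (simp add: se a_run sum.cartesian_product)
  have a_le: "a k \<le> real (?v k) - real (?v (Suc k))" if k: "k \<in> {1..K}" for k
  proof -
    have "(\<Sum>j\<in>W k. run A I k i j) \<le> 1" if "i \<in> U k" for i
    proof -
      have "{j. (i, j) \<in> stage_edges I k} = W k" using that se[OF k] by auto
      moreover have "i \<in> batch I k" using that by (simp add: I_def)
      ultimately show ?thesis using feasible_online_le[OF feas k] by metis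
    qed
    then have "a k \<le> real (card (U k))"
      unfolding a_run[OF k] using sum_bounded_above[of "U k" _ "1::real"] by simp
    then show ?thesis
      using U(2)[of k] layer_size_Suc_less[OF k] by (simp add: of_nat_diff)
  qed
  \<comment> \<open>A vertex of \<open>W K\<close> lies in every earlier \<open>W k\<close>, so its
    loads from all stages count against its unit capacity.\<close>
  have "(\<Sum>k=1..K. F W k j) \<le> 1" if "j \<in> W K" for j
  proof -
    have "j \<in> offline I" using W_sub[of 1 K] that \<open>1 \<le> K\<close> by (auto simp: I_def)
    then have "(\<Sum>k=1..K. \<Sum>i | (i, j) \<in> stage_edges I k. run A I k i j) \<le> 1"
      by (rule feasible_offline_le[OF feas])
    moreover
    have "{i. (i, j) \<in> stage_edges I k} = U k" if k: "k \<in> {1..K}" for k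
      using W_sub[of k K] k \<open>j \<in> W K\<close> se[OF k] by auto
    then have "(\<Sum>k=1..K. F W k j) = (\<Sum>k=1..K. \<Sum>i | (i, j) \<in> stage_edges I k. run A I k i j)"
      by (intro sum.cong refl) (simp add: F_run)
    ultimately show ?thesis by simp
  qed
  then have "(\<Sum>j\<in>W K. \<Sum>k=1..K. F W k j) \<le> real (?v K)"
    using sum_bounded_above[of "W K" _ "1::real"] card[of K] \<open>1 \<le> K\<close> by simp
  also have "{1..K} = insert K {1..<K}" using \<open>1 \<le> K\<close> by auto
  finally have "(\<Sum>j\<in>W K. \<Sum>k=1..<K. F W k j) + a K \<le> real (?v K)"
    by (simp add: sum.distrib a_def add.commute)
  with load have "real (?v K) * (\<Sum>k=1..<K. a k / ?v k) + a K \<le> real (?v K)"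
    by (simp add: a_def)
  moreover have "(\<Sum>k=1..K. a k) = (\<Sum>k=1..<K. a k) + a K"
    using \<open>{1..K} = insert K {1..<K}\<close> by simp
  \<comment> \<open>The amount \<open>a K\<close> is replaced by the capacity that the earlier load
    leaves on \<open>W K\<close>.\<close>
  ultimately have "(\<Sum>k=1..K. a k) \<le> ?v K + (\<Sum>k=1..<K. a k * (1 - ?v K / ?v k))"
    by (simp add: algebra_simps sum_subtractf sum_distrib_left)
  also have "\<dots> \<le> (1 - (1 - 1 / real K) ^ K) * ?v 1"
    using \<open>1 \<le> K\<close> a_le by (intro layer_size_bound) auto
  also have "\<dots> \<le> (1 - (1 - 1 / real K) ^ K) * opt I"
    using opt \<open>1 \<le> K\<close> by (intro mult_left_mono) (auto intro!: power_le_one)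
  finally have "det_value K A I \<le> (1 - (1 - 1 / real K) ^ K) * opt I"
    by (simp only: total)
  moreover have "0 < opt I"
    using opt layer_size_pos[of 1 K] \<open>1 \<le> K\<close> by simp
  ultimately show ?thesis using inst by blast
qed

lemma det_competitive_ratio_le:
  fixes A :: "('u::infinite, 'v::infinite) policy"
  assumes "1 \<le> K" and A: "det_algorithm K A"
  shows "competitive_ratio K (det_value K A) \<le> 1 - (1 - 1 / real K) ^ K"
proof -
  obtain I where I: "stage_instance K I" "0 < opt I"
      "det_value K A I \<le> (1 - (1 - 1 / real K) ^ K) * opt I"
    using hard_instance_exists[OF assms] by blast
  \<comment> \<open>A real infimum is known to lie below the ratio of \<open>I\<close> only once the
    set of ratios is bounded below.\<close>
  have "0 \<le> det_value K A J / opt J" if "stage_instance K J" for J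
  proof -
    have "feasible K J (run A J)" using A that by (simp add: det_algorithm_def)
    then show ?thesis
      unfolding det_value_def matching_size_def
      by (intro divide_nonneg_nonneg sum_nonneg) (auto intro: feasible_nonneg)
  qed
  then have "bdd_below ((\<lambda>J. det_value K A J / opt J) ` {J. stage_instance K J \<and> 0 < opt J})"
    by (intro bdd_belowI[of _ 0]) auto
  then have "competitive_ratio K (det_value K A) \<le> det_value K A I / opt I"
    unfolding competitive_ratio_def using I by (intro cINF_lower) auto
  also have "\<dots> \<le> 1 - (1 - 1 / real K) ^ K"
    using I by (simp add: divide_le_eq)
  finally show ?thesis .
qed

section \<open>Randomized algorithms\<close>

text \<open>Averaging over the seed for each history separately keeps the policy online. Where an
  entry is not integrable the integral is 0 by default; \<open>integrable_run\<close> excludes this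
  on the edges of an instance.\<close>

definition mean_policy :: "'w measure \<Rightarrow> ('w \<Rightarrow> ('u, 'v) policy) \<Rightarrow> ('u, 'v) policy" where
  "mean_policy M R S h i j = (\<integral>\<omega>. R \<omega> S h i j \<partial>M)"

lemma run_mean_policy: "run (mean_policy M R) I k i j = (\<integral>\<omega>. run (R \<omega>) I k i j \<partial>M)"
  by (simp add: run_def mean_policy_def)

lemma finite_stage_edges:
  assumes "stage_instance K I"
  shows "finite (stage_edges I k)"
  using finite_matching_cards(1)[OF assms] by (simp add: stage_edges_def)

lemma finite_stage_edges_sections:
  assumes "stage_instance K I"
  shows "finite {i. (i, j) \<in> stage_edges I k}" "finite {j. (i, j) \<in> stage_edges I k}"
proof -
  have "{i. (i, j) \<in> stage_edges I k} \<subseteq> fst ` stage_edges I k"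
    "{j. (i, j) \<in> stage_edges I k} \<subseteq> snd ` stage_edges I k" by force+
  then show "finite {i. (i, j) \<in> stage_edges I k}" "finite {j. (i, j) \<in> stage_edges I k}"
    using finite_stage_edges[OF assms] by (meson finite_imageI finite_subset)+
qed

lemma feasible_le_one:
  assumes "stage_instance K I" "feasible K I x" "k \<in> {1..K}" "(i, j) \<in> stage_edges I k"
  shows "x k i j \<le> 1"
proof -
  have "x k i j \<le> (\<Sum>j | (i, j) \<in> stage_edges I k. x k i j)"
    using finite_stage_edges_sections(2)[OF assms(1)] assms(4) feasible_nonneg[OF assms(2,3)]
    by (intro member_le_sum) auto
  also have "i \<in> batch I k" using assms(4) by (simp add: stage_edges_def)
  then have "(\<Sum>j | (i, j) \<in> stage_edges I k. x k i j) \<le> 1"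
    using assms(2,3) by (intro feasible_online_le)
  finally show ?thesis .
qed

text \<open>Feasible entries on edges lie between 0 and 1, and bounded measurable functions are
  integrable on a probability space.\<close>

lemma integrable_run:
  assumes R: "rand_algorithm K M R" and I: "stage_instance K I"
    and "k \<in> {1..K}" "(i, j) \<in> stage_edges I k"
  shows "integrable M (\<lambda>\<omega>. run (R \<omega>) I k i j)"
proof -
  interpret prob_space M using R by (simp add: rand_algorithm_def)
  have "norm (run (R \<omega>) I k i j) \<le> 1" if "\<omega> \<in> space M" for \<omega>
  proof -
    have feas: "feasible K I (run (R \<omega>) I)"
      using R I that by (simp add: rand_algorithm_def det_algorithm_def)
    then have "0 \<le> run (R \<omega>) I k i j"
      using assms(3,4) by (rule feasible_nonneg)
    with feasible_le_one[OF I feas assms(3,4)] show ?thesis by simp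
  qed
  moreover have "(\<lambda>\<omega>. run (R \<omega>) I k i j) \<in> borel_measurable M"
    using R I assms(3,4) unfolding rand_algorithm_def by blast
  ultimately show ?thesis
    by (intro integrable_const_bound[where B = 1]) auto
qed

text \<open>Each constraint is a linear inequality in finitely many integrable entries and holds for
  every seed, so it survives taking expectations.\<close>

lemma det_algorithm_mean_policy:
  fixes R :: "'w \<Rightarrow> ('u, 'v) policy"
  assumes R: "rand_algorithm K M R"
  shows "det_algorithm K (mean_policy M R)"
  unfolding det_algorithm_def
proof (intro allI impI)
  fix I :: "('u, 'v) stage_graph" assume I: "stage_instance K I"
  interpret prob_space M using R by (simp add: rand_algorithm_def)
  have feas: "feasible K I (run (R \<omega>) I)" if "\<omega> \<in> space M" for \<omega>
    using R I that by (simp add: rand_algorithm_def det_algorithm_def)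
  note int = integrable_run[OF R I]
  show "feasible K I (run (mean_policy M R) I)"
    unfolding feasible_def run_mean_policy
  proof (intro conjI ballI)
    fix k e assume k: "k \<in> {1..K}" "e \<in> stage_edges I k"
    show "case e of (i, j) \<Rightarrow> 0 \<le> (\<integral>\<omega>. run (R \<omega>) I k i j \<partial>M)"
      using k by (auto split: prod.split intro!: integral_nonneg_AE AE_I2 feasible_nonneg[OF feas])
  next
    fix k i assume k: "k \<in> {1..K}" "i \<in> batch I k"
    have "(\<Sum>j | (i, j) \<in> stage_edges I k. \<integral>\<omega>. run (R \<omega>) I k i j \<partial>M)
        = (\<integral>\<omega>. (\<Sum>j | (i, j) \<in> stage_edges I k. run (R \<omega>) I k i j) \<partial>M)"
      using k int by (subst Bochner_Integration.integral_sum) auto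
    also have "\<dots> \<le> 1"
      using k int
      by (intro integral_le_const Bochner_Integration.integrable_sum AE_I2
            feasible_online_le[OF feas]) auto
    finally show "(\<Sum>j | (i, j) \<in> stage_edges I k. \<integral>\<omega>. run (R \<omega>) I k i j \<partial>M) \<le> 1" .
  next
    fix j assume j: "j \<in> offline I"
    have "(\<Sum>k = 1..K. \<Sum>i | (i, j) \<in> stage_edges I k. \<integral>\<omega>. run (R \<omega>) I k i j \<partial>M)
        = (\<Sum>k = 1..K. \<integral>\<omega>. (\<Sum>i | (i, j) \<in> stage_edges I k. run (R \<omega>) I k i j) \<partial>M)"
      using int by (intro sum.cong refl Bochner_Integration.integral_sum[symmetric]) auto
    also have "\<dots> = (\<integral>\<omega>. (\<Sum>k = 1..K. \<Sum>i | (i, j) \<in> stage_edges I k. run (R \<omega>) I k i j) \<partial>M)"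
      using int
      by (intro Bochner_Integration.integral_sum[symmetric] Bochner_Integration.integrable_sum) auto
    also have "\<dots> \<le> 1"
      using j int
      by (intro integral_le_const Bochner_Integration.integrable_sum AE_I2
            feasible_offline_le[OF feas]) auto
    finally show
      "(\<Sum>k = 1..K. \<Sum>i | (i, j) \<in> stage_edges I k. \<integral>\<omega>. run (R \<omega>) I k i j \<partial>M) \<le> 1" .
  qed
qed

lemma det_value_mean_policy:
  assumes R: "rand_algorithm K M R" and I: "stage_instance K I"
  shows "det_value K (mean_policy M R) I = rand_value K M R I"
proof -
  note int = integrable_run[OF R I]
  have "rand_value K M R I
      = (\<Sum>k = 1..K. \<integral>\<omega>. (\<Sum>(i, j)\<in>stage_edges I k. run (R \<omega>) I k i j) \<partial>M)"
    unfolding rand_value_def det_value_def matching_size_def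
    using int
    by (intro Bochner_Integration.integral_sum Bochner_Integration.integrable_sum)
       (auto simp: case_prod_beta)
  also have "\<dots> = (\<Sum>k = 1..K. \<Sum>(i, j)\<in>stage_edges I k. \<integral>\<omega>. run (R \<omega>) I k i j \<partial>M)"
    using int unfolding case_prod_beta
    by (intro sum.cong refl Bochner_Integration.integral_sum) auto
  finally show ?thesis
    by (simp add: det_value_def matching_size_def run_mean_policy)
qed

theorem theorem3:
  fixes K :: nat
  assumes "1 \<le> K"
  shows "(\<forall>A :: ('u::infinite, 'v::infinite) policy. det_algorithm K A \<longrightarrow>
            competitive_ratio K (det_value K A) \<le> 1 - (1 - 1 / real K) ^ K) \<and>
         (\<forall>(M :: 'w measure) (R :: 'w \<Rightarrow> ('u, 'v) policy). rand_algorithm K M R \<longrightarrow>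
            competitive_ratio K (rand_value K M R) \<le> 1 - (1 - 1 / real K) ^ K)"
proof (intro conjI allI impI)
  fix A :: "('u, 'v) policy" assume "det_algorithm K A"
  with assms show "competitive_ratio K (det_value K A) \<le> 1 - (1 - 1 / real K) ^ K"
    by (rule det_competitive_ratio_le)
next
  fix M :: "'w measure" and R :: "'w \<Rightarrow> ('u, 'v) policy"
  assume R: "rand_algorithm K M R"
  \<comment> \<open>The two values agree on every stage instance, so both infima range over the same
    ratios.\<close>
  have "competitive_ratio K (rand_value K M R) = competitive_ratio K (det_value K (mean_policy M R))"
    unfolding competitive_ratio_def
    by (intro arg_cong[where f = Inf] image_cong) (auto simp: det_value_mean_policy[OF R])
  also have "\<dots> \<le> 1 - (1 - 1 / real K) ^ K"
    using assms det_algorithm_mean_policy[OF R] by (rule det_competitive_ratio_le)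
  finally show "competitive_ratio K (rand_value K M R) \<le> 1 - (1 - 1 / real K) ^ K" .
qed

end
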